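(* Let $K\subset\mathbb{R}$ be a compact set with infinitely many points and let $w\colon K\to(0,\infty)$ be continuous. Fix $D\in\mathbb{N}$, a finite (nonempty) list of layer-degree patterns $(d_1,\dots,d_L)$, each satisfying $\prod_{\ell} d_\ell\le D$, and a real number $\alpha\ge 0$, and let $\mathcal{Q}_D'$ be the corresponding family of weighted deep polynomials. For every $f\in C(K)$ the value $$E^{*}:=\inf_{Q\in\mathcal{Q}_D'}\|f-Q\|_{\infty,K}$$ is attained by some $Q^{*}=[w]^{\alpha}P^{*}$, where $P^{*}$ is a polynomial with $\deg P^{*}\le D$ and $Q^{*}$ lies in the uniform closure of $\mathcal{Q}_D'$ in $C(K)$; that is, there is such a $Q^*$ with $\|f-Q^{*}\|_{\infty,K}=E^{*}$.
   Context: $C(K)$ is the space of real-valued continuous functions on $K$ with the uniform norm $\|g\|_{\infty,K}:=\max_{x\in K}|g(x)|$. Polynomials are univariate algebraic polynomials with real coefficients. A layer-degree pattern is a finite tuple $(d_1,\dots,d_L)$ of integers $d_\ell\ge 1$ with $L\ge 1$ (the length $L$ may differ between patterns in the list). Given a finite list of patterns and a fixed $\alpha\ge 0$, the corresponding family $\mathcal{Q}_D'$ is the set of all functions on $K$ of the form $[w]^{\alpha}\,(p_1\circ p_2\circ\cdots\circ p_L)$, where $(d_1,\dots,d_L)$ is a pattern in the list and $p_1,\dots,p_L$ are polynomials with $\deg p_\ell=d_\ell$. Here $[w]^\alpha$ denotes the pointwise power $x\mapsto w(x)^\alpha$. *)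

theory Defs
  imports "HOL-Analysis.Analysis"
begin

text \<open>
  Elements of \<open>C_space K\<close> are extensional functions (\<open>undefined\<close> outside \<open>K\<close>), so that
  functions on \<open>K\<close> are equal iff they agree on \<open>K\<close>.  Lemmas \<open>mspace_C_space\<close> and
  \<open>mdist_C_space\<close> below show that, for compact \<open>K\<close>, this is the usual space of continuous
  functions with the metric of the uniform norm.
\<close>

definition C_space :: "real set \<Rightarrow> (real \<Rightarrow> real) metric" where
  "C_space K = cfunspace (top_of_set K) euclidean_metric"

text \<open>The supremum is a maximum if \<open>K\<close> is compact and nonempty and \<open>g\<close> is continuous on \<open>K\<close>.\<close>

definition uniform_norm :: "real set \<Rightarrow> (real \<Rightarrow> real) \<Rightarrow> real" where
  "uniform_norm K g = (SUP x\<in>K. \<bar>g x\<bar>)"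

definition layer_pattern :: "nat list \<Rightarrow> bool" where
  "layer_pattern ds \<longleftrightarrow> ds \<noteq> [] \<and> (\<forall>d\<in>set ds. 1 \<le> d)"

definition layer_comp :: "real poly list \<Rightarrow> real \<Rightarrow> real" where
  "layer_comp ps = foldr (\<circ>) (map poly ps) id"

definition weighted :: "real set \<Rightarrow> (real \<Rightarrow> real) \<Rightarrow> real \<Rightarrow> (real \<Rightarrow> real) \<Rightarrow> real \<Rightarrow> real" where
  "weighted K w \<alpha> g = restrict (\<lambda>x. w x powr \<alpha> * g x) K"

definition weighted_deep_polys ::
    "real set \<Rightarrow> (real \<Rightarrow> real) \<Rightarrow> real \<Rightarrow> nat list list \<Rightarrow> (real \<Rightarrow> real) set" where
  "weighted_deep_polys K w \<alpha> pats =
     {weighted K w \<alpha> (layer_comp ps) | ps ds. ds \<in> set pats \<and> list_all2 (\<lambda>p d. degree p = d) ps ds}"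

lemma mspace_C_space:
  assumes "compact K"
  shows "mspace (C_space K) = {f \<in> extensional K. continuous_on K f}"
proof -
  have "Metric_space.mbounded UNIV dist (f ` K)" if "continuous_on K f" for f :: "real \<Rightarrow> real"
    using compact_continuous_image[OF that assms] compact_imp_bounded by auto
  then show ?thesis
    by (auto simp: C_space_def)
qed

lemma mdist_C_space:
  assumes "compact K" "K \<noteq> {}" "f \<in> mspace (C_space K)" "g \<in> mspace (C_space K)"
  shows "mdist (C_space K) f g = uniform_norm K (\<lambda>x. f x - g x)"
proof -
  have "f \<in> Metric_space.fspace UNIV dist K" "g \<in> Metric_space.fspace UNIV dist K"
    using assms by (auto simp: C_space_def Met_TC.fspace_def)
  then show ?thesis
    using assms(2) by (simp add: C_space_def mdist_cfunspace_eq_mdist_funspace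
        Met_TC.fdist_def uniform_norm_def dist_real_def)
qed

end

theory Submission
  imports Defs
begin

text \<open>
  Every member of the family is \<open>w powr \<alpha>\<close> times a polynomial of degree at most \<open>D\<close>.  For a
  minimizing sequence these polynomials are uniformly bounded on \<open>K\<close>, because \<open>w powr \<alpha>\<close> is
  bounded away from \<open>0\<close>.  By Lagrange interpolation at \<open>D + 1\<close> points of \<open>K\<close> they are determined
  by \<open>D + 1\<close> bounded values, so a subsequence converges uniformly on \<open>K\<close> to such a polynomial,
  and the distance to \<open>f\<close> passes to the limit.
\<close>

section \<open>Lagrange interpolation over a field\<close>

definition lagrange_basis :: "'a::field set \<Rightarrow> 'a \<Rightarrow> 'a poly" where
  "lagrange_basis T t = (\<Prod>s\<in>T - {t}. smult (inverse (t - s)) [:- s, 1:])"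

lemma degree_lagrange_basis:
  assumes "finite T" "t \<in> T"
  shows "degree (lagrange_basis T t) < card T"
proof -
  have "degree (lagrange_basis T t)
      \<le> (\<Sum>s\<in>T - {t}. degree (smult (inverse (t - s)) [:- s, 1:]))"
    unfolding lagrange_basis_def using assms(1)
    by (intro degree_prod_sum_le[unfolded o_def]) simp
  also have "\<dots> \<le> (\<Sum>s\<in>T - {t}. 1)"
    by (rule sum_mono) auto
  also have "\<dots> < card T"
    using card_Diff1_less[OF assms] by (simp del: card_Diff_insert card_Diff_singleton)
  finally show ?thesis .
qed

lemma poly_lagrange_basis:
  assumes "finite T" "t \<in> T" "x \<in> T"
  shows "poly (lagrange_basis T t) x = (if x = t then 1 else 0)"
proof (cases "x = t")
  case True
  have "poly (smult (inverse (t - s)) [:- s, 1:]) t = 1" if "s \<in> T - {t}" for s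
  proof -
    have "poly (smult (inverse (t - s)) [:- s, 1:]) t = inverse (t - s) * (t - s)"
      by (simp add: algebra_simps)
    also have "\<dots> = 1"
      using that by (intro left_inverse) auto
    finally show ?thesis .
  qed
  then show ?thesis
    unfolding lagrange_basis_def poly_prod using True by (simp del: poly_smult)
next
  case False
  \<comment> \<open>The factor with \<open>s = x\<close> vanishes at \<open>x\<close>.\<close>
  then show ?thesis
    using assms by (auto simp: lagrange_basis_def poly_prod)
qed

text \<open>Both sides agree at the \<open>card T\<close> nodes and have degree below
  \<open>card T\<close>, so their difference has too many roots to be nonzero.\<close>

lemma lagrange_interpolation:
  fixes p :: "'a::field poly"
  assumes "finite T" "degree p < card T"
  shows "p = (\<Sum>t\<in>T. smult (poly p t) (lagrange_basis T t))"
proof (rule poly_eqI_degree[of T])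
  show "poly p x = poly (\<Sum>t\<in>T. smult (poly p t) (lagrange_basis T t)) x" if "x \<in> T" for x
    using assms that by (simp add: poly_sum poly_lagrange_basis if_distrib cong: if_cong)
  have "degree (\<Sum>t\<in>T. smult (poly p t) (lagrange_basis T t)) \<le> card T - 1"
    using assms(1) by (intro degree_sum_le order_trans[OF degree_smult_le])
      (use degree_lagrange_basis in fastforce)+
  then show "degree (\<Sum>t\<in>T. smult (poly p t) (lagrange_basis T t)) < card T"
    using assms(2) by linarith
qed (use assms in auto)

section \<open>Compactness for bounded polynomials of bounded degree\<close>

lemma finite_family_convergent_subsequence:
  fixes X :: "nat \<Rightarrow> 'i \<Rightarrow> 'a::heine_borel"
  assumes "finite I" "\<And>i. i \<in> I \<Longrightarrow> bounded (range (\<lambda>n. X n i))"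
  shows "\<exists>r l. strict_mono (r :: nat \<Rightarrow> nat) \<and> (\<forall>i\<in>I. (\<lambda>n. X (r n) i) \<longlonglongrightarrow> l i)"
  using assms
proof (induction I rule: finite_induct)
  case empty
  show ?case
    using strict_mono_id by blast
next
  case (insert j I)
  then obtain r l where r: "strict_mono (r :: nat \<Rightarrow> nat)"
    and l: "\<And>i. i \<in> I \<Longrightarrow> (\<lambda>n. X (r n) i) \<longlonglongrightarrow> l i"
    by fastforce
  \<comment> \<open>Thin out once more for the new index \<open>j\<close>; limits already obtained
    survive passing to a further subsequence.\<close>
  have "bounded (range (\<lambda>n. X (r n) j))"
    by (rule bounded_subset[OF insert.prems[of j]]) auto
  then obtain m s where s: "strict_mono (s :: nat \<Rightarrow> nat)"
    and m: "(\<lambda>n. X (r (s n)) j) \<longlonglongrightarrow> m"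
    using bounded_imp_convergent_subsequence[of "\<lambda>n. X (r n) j"] by (auto simp: o_def)
  have "(\<lambda>n. X (r (s n)) i) \<longlonglongrightarrow> (l(j := m)) i" if "i \<in> insert j I" for i
    using that m LIMSEQ_subseq_LIMSEQ[OF l s] by (auto simp: o_def)
  moreover have "strict_mono (\<lambda>n. r (s n))"
    using strict_mono_o[OF r s] by (simp add: o_def)
  ultimately show ?case
    by blast
qed

lemma uniform_limit_sum:
  fixes f :: "'i \<Rightarrow> 'a \<Rightarrow> 'b \<Rightarrow> 'c::real_normed_vector"
  assumes "\<And>i. i \<in> I \<Longrightarrow> uniform_limit S (f i) (l i) F"
  shows "uniform_limit S (\<lambda>n x. \<Sum>i\<in>I. f i n x) (\<lambda>x. \<Sum>i\<in>I. l i x) F"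
  using assms
  \<comment> \<open>For infinite \<open>I\<close> both sums are 0 by convention.\<close>
  by (induction I rule: infinite_finite_induct)
    (auto intro!: uniform_limit_const uniform_limit_add)

text \<open>Values at fixed nodes act as coordinates: convergence of finitely many real sequences
  controls the polynomials on all of \<open>K\<close>.\<close>

lemma bounded_polys_convergent_subsequence:
  fixes K :: "real set" and p :: "nat \<Rightarrow> real poly"
  assumes "compact K" "infinite K"
    and deg: "\<And>n. degree (p n) \<le> D"
    and bnd: "\<And>n x. x \<in> K \<Longrightarrow> \<bar>poly (p n) x\<bar> \<le> B"
  obtains r P where "strict_mono (r :: nat \<Rightarrow> nat)" "degree P \<le> D"
    "uniform_limit K (\<lambda>n. poly (p (r n))) (poly P) sequentially"
proof -
  \<comment> \<open>One node more than \<open>D\<close>, so that degree at most \<open>D\<close> is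
    strictly below \<open>card T\<close>.\<close>
  obtain T where T: "finite T" "card T = Suc D" "T \<subseteq> K"
    using infinite_arbitrarily_large[OF \<open>infinite K\<close>] by metis
  have "bounded (range (\<lambda>n. poly (p n) t))" if "t \<in> T" for t
    using bnd T that by (intro boundedI[of _ B]) auto
  then obtain r l where r: "strict_mono (r :: nat \<Rightarrow> nat)"
    and l: "\<And>t. t \<in> T \<Longrightarrow> (\<lambda>n. poly (p (r n)) t) \<longlonglongrightarrow> l t"
    using finite_family_convergent_subsequence[OF T(1), of "\<lambda>n. poly (p n)"] by blast
  define P where "P = (\<Sum>t\<in>T. smult (l t) (lagrange_basis T t))"
  have "degree P \<le> D"
    unfolding P_def using T degree_lagrange_basis[OF T(1)]
    by (intro degree_sum_le order_trans[OF degree_smult_le]) (auto simp: less_Suc_eq_le)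
  moreover have "uniform_limit K (\<lambda>n. poly (p (r n))) (poly P) sequentially"
  proof -
    \<comment> \<open>The first factor is constant in \<open>x\<close> and converges; the second is
      independent of \<open>n\<close> and bounded on the compact \<open>K\<close>.\<close>
    have "uniform_limit K (\<lambda>n x. poly (p (r n)) t * poly (lagrange_basis T t) x)
        (\<lambda>x. l t * poly (lagrange_basis T t) x) sequentially" if "t \<in> T" for t
    proof (rule uniform_lim_mult)
      show "uniform_limit K (\<lambda>n x. poly (p (r n)) t) (\<lambda>x. l t) sequentially"
        using l[OF that] by (auto simp: uniform_limit_iff tendsto_iff elim: eventually_mono)
      show "bounded (poly (lagrange_basis T t) ` K)"
        using \<open>compact K\<close> by (intro compact_imp_bounded compact_continuous_image continuous_intros)
      show "bounded ((\<lambda>x. l t) ` K)"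
        by (rule bounded_subset[of "{l t}"]) auto
    qed (rule uniform_limit_const)
    then have "uniform_limit K
        (\<lambda>n x. \<Sum>t\<in>T. poly (p (r n)) t * poly (lagrange_basis T t) x)
        (\<lambda>x. \<Sum>t\<in>T. l t * poly (lagrange_basis T t) x) sequentially"
      by (rule uniform_limit_sum)
    moreover have "(\<Sum>t\<in>T. poly q t * poly (lagrange_basis T t) x) = poly q x"
      if "degree q \<le> D" for q :: "real poly" and x
      using arg_cong[OF lagrange_interpolation[OF T(1), of q], of "\<lambda>q. poly q x"] that T(2)
      by (simp add: poly_sum)
    moreover have "(\<Sum>t\<in>T. l t * poly (lagrange_basis T t) x) = poly P x" for x
      by (simp add: P_def poly_sum)
    ultimately show ?thesis
      using deg by simp
  qed
  ultimately show ?thesis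
    using r that by blast
qed

section \<open>Deep polynomials as ordinary polynomials\<close>

lemma layer_comp_eq_poly:
  assumes "list_all2 (\<lambda>p d. degree p = d) ps ds"
  shows "\<exists>p. layer_comp ps = poly p \<and> degree p = prod_list ds"
  using assms
proof (induction rule: list_all2_induct)
  case Nil
  \<comment> \<open>The empty composition is the identity, whose degree 1 matches the empty
    product.\<close>
  have "layer_comp [] = poly [:0, 1:]"
    by (auto simp: layer_comp_def)
  then show ?case
    by (intro exI[of _ "[:0, 1:]"]) simp
next
  case (Cons p ps d ds)
  then obtain q where "layer_comp ps = poly q" "degree q = prod_list ds"
    by blast
  moreover have "layer_comp (p # ps) = poly p \<circ> layer_comp ps"
    by (simp add: layer_comp_def)
  ultimately show ?case
    using Cons by (intro exI[of _ "pcompose p q"]) (auto simp: poly_pcompose degree_pcompose)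
qed

text \<open>Makes the infimum meaningful; monomials of the prescribed degrees realize the first
  pattern.\<close>

lemma weighted_deep_polys_nonempty:
  assumes "pats \<noteq> []"
  shows "weighted_deep_polys K w \<alpha> pats \<noteq> {}"
proof -
  have "list_all2 (\<lambda>p d. degree p = d) (map (monom 1) (hd pats) :: real poly list) (hd pats)"
    by (simp add: list_all2_conv_all_nth degree_monom_eq)
  then show ?thesis
    using assms hd_in_set unfolding weighted_deep_polys_def by blast
qed

text \<open>Embeds the nonlinear family in a finite-dimensional linear space, where compactness is
  available.\<close>

lemma weighted_deep_polysE:
  assumes "q \<in> weighted_deep_polys K w \<alpha> pats" "\<forall>ds\<in>set pats. prod_list ds \<le> D"
  obtains p where "degree p \<le> D" "q = weighted K w \<alpha> (poly p)"
proof -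
  obtain ps ds where "ds \<in> set pats" "list_all2 (\<lambda>p d. degree p = d) ps ds"
    and q: "q = weighted K w \<alpha> (layer_comp ps)"
    using assms(1) unfolding weighted_deep_polys_def by blast
  moreover from this obtain p where "layer_comp ps = poly p" "degree p = prod_list ds"
    using layer_comp_eq_poly by blast
  ultimately show ?thesis
    using assms(2) that[of p] by simp
qed

section \<open>Weighted polynomials in C(K)\<close>

lemma weighted_mem_C_space:
  assumes "compact K" "continuous_on K w" "\<forall>x\<in>K. 0 < w x" "continuous_on K g"
  shows "weighted K w \<alpha> g \<in> mspace (C_space K)"
proof -
  \<comment> \<open>Positivity of \<open>w\<close> keeps the base of \<open>powr\<close> nonzero,
    which gives continuity of the weight.\<close>
  have "continuous_on K (\<lambda>x. w x powr \<alpha> * g x)"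
    using assms by (intro continuous_intros) auto
  then show ?thesis
    using assms by (simp add: mspace_C_space weighted_def cong: continuous_on_cong)
qed

lemma abs_le_uniform_norm:
  assumes "compact K" "continuous_on K g" "x \<in> K"
  shows "\<bar>g x\<bar> \<le> uniform_norm K g"
proof -
  have "bounded ((\<lambda>x. \<bar>g x\<bar>) ` K)"
    using assms by (intro compact_imp_bounded compact_continuous_image continuous_intros)
  then show ?thesis
    unfolding uniform_norm_def
    using assms(3) by (intro cSUP_upper bounded_imp_bdd_above)
qed

lemma limitin_C_space:
  assumes "compact K" "K \<noteq> {}" "\<And>n. g n \<in> mspace (C_space K)" "h \<in> mspace (C_space K)"
    and lim: "uniform_limit K g h sequentially"
  shows "limitin (mtopology_of (C_space K)) g h sequentially"
proof -
  have "\<forall>\<^sub>F n in sequentially. mdist (C_space K) (g n) h < e" if "e > 0" for e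
  proof -
    \<comment> \<open>Strict pointwise bounds give only a weak bound on the supremum;
      \<open>e / 2\<close> leaves room for strictness.\<close>
    have "\<forall>\<^sub>F n in sequentially. \<forall>x\<in>K. dist (g n x) (h x) < e / 2"
      using uniform_limitD[OF lim, of "e / 2"] that by simp
    then show ?thesis
    proof eventually_elim
      case (elim n)
      then have "uniform_norm K (\<lambda>x. g n x - h x) \<le> e / 2"
        unfolding uniform_norm_def using \<open>K \<noteq> {}\<close>
        by (intro cSUP_least) (auto simp: dist_real_def less_imp_le)
      then show ?case
        using that assms by (simp add: mdist_C_space)
    qed
  qed
  then show ?thesis
    using assms by (simp add: mtopology_of_def Metric_space.limitin_metric)
qed

lemma weighted_polys_convergent_subsequence:
  assumes "compact K" "infinite K" "continuous_on K w" "\<forall>x\<in>K. 0 < w x"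
    and deg: "\<And>n. degree (p n) \<le> D"
    and f: "f \<in> mspace (C_space K)"
    and bnd: "\<And>n. mdist (C_space K) f (weighted K w \<alpha> (poly (p n))) \<le> B"
  obtains r P where "strict_mono (r :: nat \<Rightarrow> nat)" "degree P \<le> D"
    "limitin (mtopology_of (C_space K)) (\<lambda>n. weighted K w \<alpha> (poly (p (r n))))
      (weighted K w \<alpha> (poly P)) sequentially"
proof -
  note mem = weighted_mem_C_space[OF assms(1,3,4)]
  have "K \<noteq> {}"
    using \<open>infinite K\<close> by auto
  have contw: "continuous_on K (\<lambda>x. w x powr \<alpha>)"
    using assms by (intro continuous_intros) auto
  obtain x0 where x0: "x0 \<in> K" "\<And>x. x \<in> K \<Longrightarrow> w x0 powr \<alpha> \<le> w x powr \<alpha>"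
    using continuous_attains_inf[OF \<open>compact K\<close> \<open>K \<noteq> {}\<close> contw] by blast
  \<comment> \<open>The minimum of the weight on \<open>K\<close>, positive because \<open>w\<close>
    is.\<close>
  define c where "c = w x0 powr \<alpha>"
  have "c > 0"
    using x0 assms(4) by (auto simp: c_def)
  have contf: "continuous_on K f"
    using f \<open>compact K\<close> by (simp add: mspace_C_space)
  \<comment> \<open>By the triangle inequality, \<open>c * \<bar>poly (p n) x\<bar>\<close> is at
    most \<open>\<bar>f x\<bar>\<close> plus the error at \<open>x\<close>; divide by
    \<open>c\<close>.\<close>
  have poly_bnd: "\<bar>poly (p n) x\<bar> \<le> (uniform_norm K f + B) / c" if "x \<in> K" for n x
  proof -
    let ?q = "weighted K w \<alpha> (poly (p n))"
    have q: "?q \<in> mspace (C_space K)"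
      by (intro mem continuous_intros)
    then have "continuous_on K (\<lambda>x. f x - ?q x)"
      using contf \<open>compact K\<close> by (intro continuous_intros) (simp_all add: mspace_C_space)
    then have "\<bar>f x - ?q x\<bar> \<le> B"
      using abs_le_uniform_norm[OF \<open>compact K\<close> _ that] bnd[of n]
        mdist_C_space[OF \<open>compact K\<close> \<open>K \<noteq> {}\<close> f q] by fastforce
    moreover have "\<bar>f x\<bar> \<le> uniform_norm K f"
      by (rule abs_le_uniform_norm[OF \<open>compact K\<close> contf that])
    moreover have "c * \<bar>poly (p n) x\<bar> \<le> \<bar>?q x\<bar>"
      using x0(2)[OF that] that by (auto simp: weighted_def c_def abs_mult intro: mult_right_mono)
    ultimately show ?thesis
      using \<open>c > 0\<close> by (simp add: field_simps)
  qed
  obtain r P where r: "strict_mono (r :: nat \<Rightarrow> nat)" "degree P \<le> D"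
    and lim: "uniform_limit K (\<lambda>n. poly (p (r n))) (poly P) sequentially"
    by (rule bounded_polys_convergent_subsequence[OF assms(1,2) deg poly_bnd])
  have "uniform_limit K (\<lambda>n x. w x powr \<alpha> * poly (p (r n)) x)
      (\<lambda>x. w x powr \<alpha> * poly P x) sequentially"
    using contw \<open>compact K\<close>
    by (intro uniform_lim_mult uniform_limit_const lim compact_imp_bounded
        compact_continuous_image continuous_on_poly continuous_on_id)
  then have "uniform_limit K (\<lambda>n. weighted K w \<alpha> (poly (p (r n)))) (weighted K w \<alpha> (poly P))
      sequentially"
    by (simp add: weighted_def uniform_limit_iff)
  then have "limitin (mtopology_of (C_space K)) (\<lambda>n. weighted K w \<alpha> (poly (p (r n))))
      (weighted K w \<alpha> (poly P)) sequentially"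
    using \<open>compact K\<close> \<open>K \<noteq> {}\<close> by (intro limitin_C_space mem continuous_intros)
  then show ?thesis
    using r that by blast
qed

section \<open>Existence of a best approximation in the closure\<close>

theorem theorem5p2:
  fixes K :: "real set" and w :: "real \<Rightarrow> real" and D :: nat
    and pats :: "nat list list" and \<alpha> :: real and f :: "real \<Rightarrow> real"
  assumes "compact K" and "infinite K"
    and "continuous_on K w" and "\<forall>x\<in>K. 0 < w x"
    and "pats \<noteq> []"
    and "\<forall>ds\<in>set pats. layer_pattern ds \<and> prod_list ds \<le> D"
    and "0 \<le> \<alpha>"
    and "f \<in> mspace (C_space K)"
  shows "\<exists>P :: real poly. \<exists>Q. degree P \<le> D \<and> Q = weighted K w \<alpha> (poly P) \<and>
           Q \<in> mtopology_of (C_space K) closure_of weighted_deep_polys K w \<alpha> pats \<and>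
           uniform_norm K (\<lambda>x. f x - Q x) =
             (INF q\<in>weighted_deep_polys K w \<alpha> pats. uniform_norm K (\<lambda>x. f x - q x))"
proof -
  let ?F = "weighted_deep_polys K w \<alpha> pats" and ?C = "C_space K"
  define E where "E = (INF q\<in>?F. mdist ?C f q)"
  have "K \<noteq> {}"
    using \<open>infinite K\<close> by auto
  have repr: "\<exists>p. degree p \<le> D \<and> q = weighted K w \<alpha> (poly p)" if "q \<in> ?F" for q
    using weighted_deep_polysE[OF that, of D] assms(6) by blast
  note mem = weighted_mem_C_space[OF assms(1,3,4) continuous_on_poly[OF continuous_on_id]]
  have F: "q \<in> mspace ?C" if "q \<in> ?F" for q
    using repr[OF that] mem by blast
  have "?F \<noteq> {}"
    using assms(5) by (rule weighted_deep_polys_nonempty)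
  have bdd: "bdd_below (mdist ?C f ` ?F)"
    by (rule bdd_belowI[of _ 0]) auto
  \<comment> \<open>The slack \<open>1 / (Suc n)\<close> is positive for every \<open>n\<close>,
    tends to 0 and is at most 1, which also yields one distance bound for the whole
    sequence.\<close>
  have "\<exists>p. degree p \<le> D \<and> weighted K w \<alpha> (poly p) \<in> ?F \<and>
      mdist ?C f (weighted K w \<alpha> (poly p)) < E + 1 / (Suc n)" for n
  proof -
    have "Inf (mdist ?C f ` ?F) < E + 1 / (Suc n)"
      by (simp add: E_def)
    then obtain q where "q \<in> ?F" "mdist ?C f q < E + 1 / (Suc n)"
      using cInf_lessD[of "mdist ?C f ` ?F"] \<open>?F \<noteq> {}\<close> by blast
    then show ?thesis
      using repr by blast
  qed
  then obtain p where p: "\<And>n. degree (p n) \<le> D" "\<And>n. weighted K w \<alpha> (poly (p n)) \<in> ?F"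
    "\<And>n. mdist ?C f (weighted K w \<alpha> (poly (p n))) < E + 1 / (Suc n)"
    by metis
  have dist_bnd: "mdist ?C f (weighted K w \<alpha> (poly (p n))) \<le> E + 1" for n
  proof -
    have "1 / real (Suc n) \<le> 1"
      by simp
    then show ?thesis
      using p(3)[of n] by linarith
  qed
  obtain r P where r: "strict_mono (r :: nat \<Rightarrow> nat)" and P: "degree P \<le> D"
    and lim: "limitin (mtopology_of ?C) (\<lambda>n. weighted K w \<alpha> (poly (p (r n))))
      (weighted K w \<alpha> (poly P)) sequentially"
    by (rule weighted_polys_convergent_subsequence[OF assms(1-4) p(1) assms(8) dist_bnd])
  let ?q = "\<lambda>n. weighted K w \<alpha> (poly (p (r n)))" and ?Q = "weighted K w \<alpha> (poly P)"
  have Q: "?Q \<in> mspace ?C"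
    by (rule mem)
  \<comment> \<open>Layer degrees are prescribed exactly and may drop in the limit, so membership is
    claimed only for the closure.\<close>
  have closure: "?Q \<in> mtopology_of ?C closure_of ?F"
    using lim p(2) F Q
    by (auto simp: mtopology_of_def Metric_space.closure_of_sequentially intro!: exI[of _ ?q])
  have "mdist ?C f ?Q = E"
  proof (rule antisym)
    have "(\<lambda>n. mdist ?C (?q n) ?Q) \<longlonglongrightarrow> 0"
      using lim by (simp add: mtopology_of_def Metric_space.limitin_metric_dist_null)
    moreover have "(\<lambda>n. 1 / real (Suc (r n))) \<longlonglongrightarrow> 0"
      using LIMSEQ_subseq_LIMSEQ[OF LIMSEQ_inverse_real_of_nat r] by (simp add: o_def divide_inverse)
    ultimately have "(\<lambda>n. E + 1 / real (Suc (r n)) + mdist ?C (?q n) ?Q) \<longlonglongrightarrow> E + 0 + 0"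
      by (intro tendsto_intros)
    \<comment> \<open>Triangle inequality through the \<open>r n\<close>-th near-minimizer; both
      error terms vanish in the limit.\<close>
    moreover have "mdist ?C f ?Q \<le> E + 1 / real (Suc (r n)) + mdist ?C (?q n) ?Q" for n
      using mdist_triangle[OF assms(8) F[OF p(2)] Q, of "r n"] p(3)[of "r n"] by linarith
    ultimately show "mdist ?C f ?Q \<le> E"
      by (intro LIMSEQ_le_const) auto
  next
    \<comment> \<open>\<open>?Q\<close> may lie outside the family, so the infimum is compared with
      a member within \<open>e\<close> of it.\<close>
    show "E \<le> mdist ?C f ?Q"
    proof (rule field_le_epsilon)
      fix e :: real
      assume "e > 0"
      then obtain q where q: "q \<in> ?F" "mdist ?C ?Q q < e"
        using closure by (auto simp: mtopology_of_def Metric_space.metric_closure_of Metric_space.in_mball)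
      have "E \<le> mdist ?C f q"
        unfolding E_def using bdd q(1) by (rule cINF_lower)
      also have "\<dots> \<le> mdist ?C f ?Q + mdist ?C ?Q q"
        using assms(8) Q F[OF q(1)] by (rule mdist_triangle)
      finally show "E \<le> mdist ?C f ?Q + e"
        using q(2) by simp
    qed
  qed
  \<comment> \<open>All functions involved lie in C(K), so metric distances can be read as uniform
    norms.\<close>
  moreover have "E = (INF q\<in>?F. uniform_norm K (\<lambda>x. f x - q x))"
    unfolding E_def using F assms(8) by (intro INF_cong) (simp_all add: mdist_C_space assms(1) \<open>K \<noteq> {}\<close>)
  moreover have "mdist ?C f ?Q = uniform_norm K (\<lambda>x. f x - ?Q x)"
    using assms(1) \<open>K \<noteq> {}\<close> assms(8) Q by (rule mdist_C_space)
  ultimately have "uniform_norm K (\<lambda>x. f x - ?Q x) =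
      (INF q\<in>?F. uniform_norm K (\<lambda>x. f x - q x))"
    by simp
  then show ?thesis
    using P closure by blast
qed

end
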